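(* Let $\mathcal{H}$ be a complex Hilbert space, let $A\in\mathcal{B}(\mathcal{H})$ be a positive operator, and let $T\in\mathcal{B}_A(\mathcal{H})$. Then $$w_A(T)\geq \sqrt{\frac{1}{4}\left\|T^{\sharp_A}T+TT^{\sharp_A}\right\|_A+\frac{1}{2}\left|\,\|\Re_A(T)\|_A^2-\|\Im_A(T)\|_A^2\,\right|}.$$
   Context: $\mathcal{B}(\mathcal{H})$ is the algebra of bounded linear operators on the complex Hilbert space $\mathcal{H}$ with inner product $\langle\cdot,\cdot\rangle$; $A\in\mathcal{B}(\mathcal{H})$ is positive (i.e. $\langle Ax,x\rangle\ge 0$ for all $x$), not necessarily injective. Put $\langle x,y\rangle_A=\langle Ax,y\rangle$ and $\|x\|_A=\sqrt{\langle x,x\rangle_A}$ (a seminorm on $\mathcal{H}$). $R(S)$ denotes the range of $S$ and $\overline{R(S)}$ its norm closure. $\mathcal{B}_A(\mathcal{H})=\{T\in\mathcal{B}(\mathcal{H}): R(T^*A)\subseteq R(A)\}$, equivalently the set of $T\in\mathcal{B}(\mathcal{H})$ for which there is $S\in\mathcal{B}(\mathcal{H})$ with $AS=T^*A$. For $T\in\mathcal{B}_A(\mathcal{H})$, $T^{\sharp_A}$ denotes the unique $X\in\mathcal{B}(\mathcal{H})$ with $AX=T^*A$ and $R(X)\subseteq\overline{R(A)}$. For $T\in\mathcal{B}_A(\mathcal{H})$: $\|T\|_A=\sup\{\|Tx\|_A: x\in\overline{R(A)},\ \|x\|_A=1\}=\sup\{\|Tx\|_A: x\in\mathcal{H},\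 \|x\|_A=1\}$ (finite), and $w_A(T)=\sup\{|\langle Tx,x\rangle_A|: x\in\mathcal{H},\ \|x\|_A=1\}$. Finally $\Re_A(T)=\frac{T+T^{\sharp_A}}{2}$ and $\Im_A(T)=\frac{T-T^{\sharp_A}}{2\mathrm{i}}$. *)

theory Defs
  imports "HOL-Analysis.Analysis"
begin

text \<open>Complex Hilbert spaces; the inner product is linear in its first argument.\<close>

class complex_hilbert_space = banach +
  fixes scaleC :: "complex \<Rightarrow> 'a \<Rightarrow> 'a"  (infixr "*\<^sub>C" 75)
    and cinner :: "'a \<Rightarrow> 'a \<Rightarrow> complex"
  assumes scaleC_add_right: "c *\<^sub>C (x + y) = c *\<^sub>C x + c *\<^sub>C y"
    and scaleC_add_left: "(c + d) *\<^sub>C x = c *\<^sub>C x + d *\<^sub>C x"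
    and scaleC_scaleC: "c *\<^sub>C d *\<^sub>C x = (c * d) *\<^sub>C x"
    and scaleC_of_real: "complex_of_real r *\<^sub>C x = r *\<^sub>R x"
    and cinner_commute: "cinner x y = cnj (cinner y x)"
    and cinner_add_left: "cinner (x + y) z = cinner x z + cinner y z"
    and cinner_scaleC_left: "cinner (c *\<^sub>C x) y = c * cinner x y"
    and cinner_self_nonneg: "cinner x x \<in> \<real>\<^sub>\<ge>\<^sub>0"
    and cinner_self_eq_0_iff: "cinner x x = 0 \<longleftrightarrow> x = 0"
    and norm_eq_sqrt_cinner: "norm x = sqrt (Re (cinner x x))"

instantiation complex :: complex_hilbert_space
begin

definition scaleC_complex :: "complex \<Rightarrow> complex \<Rightarrow> complex"
  where "scaleC_complex c x = c * x"

definition cinner_complex :: "complex \<Rightarrow> complex \<Rightarrow> complex"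
  where "cinner_complex x y = x * cnj y"

instance
proof
  fix x y z c d :: complex and r :: real
  show "c *\<^sub>C (x + y) = c *\<^sub>C x + c *\<^sub>C y" "(c + d) *\<^sub>C x = c *\<^sub>C x + d *\<^sub>C x"
    "c *\<^sub>C d *\<^sub>C x = (c * d) *\<^sub>C x"
    by (simp_all add: scaleC_complex_def distrib_left distrib_right mult.assoc)
  show "complex_of_real r *\<^sub>C x = r *\<^sub>R x"
    by (simp add: scaleC_complex_def scaleR_conv_of_real)
  show "cinner x y = cnj (cinner y x)" "cinner (x + y) z = cinner x z + cinner y z"
    "cinner (c *\<^sub>C x) y = c * cinner x y"
    by (simp_all add: scaleC_complex_def cinner_complex_def distrib_right)
  show "cinner x x \<in> \<real>\<^sub>\<ge>\<^sub>0" "norm x = sqrt (Re (cinner x x))"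
    by (simp_all add: cinner_complex_def complex_nonneg_Reals_iff cmod_def power2_eq_square)
  show "cinner x x = 0 \<longleftrightarrow> x = 0"
    by (simp add: cinner_complex_def)
qed

end

definition bounded_clinear :: "('a::complex_hilbert_space \<Rightarrow> 'a) \<Rightarrow> bool"
  where "bounded_clinear T \<longleftrightarrow> bounded_linear T \<and> (\<forall>c x. T (c *\<^sub>C x) = c *\<^sub>C T x)"

definition cadjoint :: "('a::complex_hilbert_space \<Rightarrow> 'a) \<Rightarrow> 'a \<Rightarrow> 'a"
  where "cadjoint T =
    (THE S. bounded_clinear S \<and> (\<forall>x y. cinner (T x) y = cinner x (S y)))"

definition positive_operator :: "('a::complex_hilbert_space \<Rightarrow> 'a) \<Rightarrow> bool"
  where "positive_operator A \<longleftrightarrow> bounded_clinear A \<and> (\<forall>x. cinner (A x) x \<in> \<real>\<^sub>\<ge>\<^sub>0)"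

definition A_inner :: "('a::complex_hilbert_space \<Rightarrow> 'a) \<Rightarrow> 'a \<Rightarrow> 'a \<Rightarrow> complex"
  where "A_inner A x y = cinner (A x) y"

definition A_norm :: "('a::complex_hilbert_space \<Rightarrow> 'a) \<Rightarrow> 'a \<Rightarrow> real"
  where "A_norm A x = sqrt (Re (A_inner A x x))"

definition A_adjointable :: "('a::complex_hilbert_space \<Rightarrow> 'a) \<Rightarrow> ('a \<Rightarrow> 'a) set"
  where "A_adjointable A =
    {T. bounded_clinear T \<and> range (cadjoint T \<circ> A) \<subseteq> range A}"

definition A_adjoint :: "('a::complex_hilbert_space \<Rightarrow> 'a) \<Rightarrow> ('a \<Rightarrow> 'a) \<Rightarrow> 'a \<Rightarrow> 'a"
  where "A_adjoint A T =
    (THE X. bounded_clinear X \<and> A \<circ> X = cadjoint T \<circ> A \<and> range X \<subseteq> closure (range A))"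

text \<open>
  The two suprema below are taken in \<open>[0, \<infinity>)\<close>. Inserting \<open>0\<close> only matters when
  \<open>A = 0\<close>: then no \<open>x\<close> has \<open>A_norm A x = 1\<close>, and \<open>Sup {}\<close> is an unspecified real number,
  whereas the supremum of the empty set of nonnegative numbers is \<open>0\<close>.
\<close>

definition A_opnorm :: "('a::complex_hilbert_space \<Rightarrow> 'a) \<Rightarrow> ('a \<Rightarrow> 'a) \<Rightarrow> real"
  where "A_opnorm A T =
    Sup (insert 0 {A_norm A (T x) | x. x \<in> closure (range A) \<and> A_norm A x = 1})"

definition A_numerical_radius :: "('a::complex_hilbert_space \<Rightarrow> 'a) \<Rightarrow> ('a \<Rightarrow> 'a) \<Rightarrow> real"
  where "A_numerical_radius A T =
    Sup (insert 0 {cmod (A_inner A (T x) x) | x. A_norm A x = 1})"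

definition A_Re :: "('a::complex_hilbert_space \<Rightarrow> 'a) \<Rightarrow> ('a \<Rightarrow> 'a) \<Rightarrow> 'a \<Rightarrow> 'a"
  where "A_Re A T = (\<lambda>x. (1 / 2) *\<^sub>C (T x + A_adjoint A T x))"

definition A_Im :: "('a::complex_hilbert_space \<Rightarrow> 'a) \<Rightarrow> ('a \<Rightarrow> 'a) \<Rightarrow> 'a \<Rightarrow> 'a"
  where "A_Im A T = (\<lambda>x. (1 / (2 * \<i>)) *\<^sub>C (T x - A_adjoint A T x))"

end

theory Submission
  imports Defs
begin

text \<open>
  Write \<open>T = H + iK\<close> with \<open>H = A_Re A T\<close>, \<open>K = A_Im A T\<close>, both symmetric for \<open>A_inner A\<close>; let
  \<open>h\<close>, \<open>k\<close> be their seminorms and \<open>w\<close> the numerical radius of \<open>T\<close>. Since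
  \<open>\<bar>\<langle>Tx, x\<rangle>\<bar>\<^sup>2 = \<langle>Hx, x\<rangle>\<^sup>2 + \<langle>Kx, x\<rangle>\<^sup>2\<close>, polarisation gives \<open>h \<le> w\<close> and \<open>k \<le> w\<close>. As
  \<open>T\<^sup>\<sharp>T + TT\<^sup>\<sharp> = 2(H\<^sup>2 + K\<^sup>2)\<close>, the quantity under the root is at most
  \<open>(h\<^sup>2 + k\<^sup>2) / 2 + \<bar>h\<^sup>2 - k\<^sup>2\<bar> / 2 = max(h\<^sup>2, k\<^sup>2)\<close>. The analytic input is that \<open>T\<^sup>\<sharp>\<close> exists and is
  bounded, and that \<open>T\<close>, \<open>H\<close>, \<open>K\<close> are bounded for the seminorm, so that all suprema are finite.
\<close>

section \<open>Inner products and the semi-inner product of a positive operator\<close>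

lemma cinner_add_right: "cinner x (y + z) = cinner x y + cinner x z"
  by (metis cinner_add_left cinner_commute complex_cnj_add)

lemma cinner_scaleC_right: "cinner x (c *\<^sub>C y) = cnj c * cinner x y"
  by (metis cinner_scaleC_left cinner_commute complex_cnj_mult)

lemma scaleC_one [simp]: "1 *\<^sub>C (x::'a::complex_hilbert_space) = x"
  using scaleC_of_real[of 1 x] by simp

lemma scaleC_minus_one [simp]: "(-1) *\<^sub>C (x::'a::complex_hilbert_space) = - x"
  using scaleC_of_real[of "-1" x] by simp

lemma scaleC_minus_right: "c *\<^sub>C (- x) = - (c *\<^sub>C (x::'a::complex_hilbert_space))"
  using scaleC_scaleC[of c "-1" x] scaleC_scaleC[of "-1" c x] by simp

lemma scaleC_diff_right: "c *\<^sub>C (x - y) = c *\<^sub>C x - c *\<^sub>C (y::'a::complex_hilbert_space)"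
  using scaleC_add_right[of c x "- y"] by (simp add: scaleC_minus_right)

lemma cinner_minus_left: "cinner (- x) y = - cinner x y"
  using cinner_scaleC_left[of "-1" x y] by simp

lemma cinner_minus_right: "cinner x (- y) = - cinner x y"
  using cinner_scaleC_right[of x "-1" y] by simp

lemma cinner_diff_left: "cinner (x - y) z = cinner x z - cinner y z"
  using cinner_add_left[of x "- y" z] by (simp add: cinner_minus_left)

lemma cinner_diff_right: "cinner x (y - z) = cinner x y - cinner x z"
  using cinner_add_right[of x y "- z"] by (simp add: cinner_minus_right)

lemma cinner_scaleR_left: "cinner (r *\<^sub>R x) y = of_real r * cinner x y"
  by (simp only: scaleC_of_real[symmetric] cinner_scaleC_left)

lemma cinner_scaleR_right: "cinner x (r *\<^sub>R y) = of_real r * cinner x y"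
  by (simp only: scaleC_of_real[symmetric] cinner_scaleC_right complex_cnj_complex_of_real)

lemma cinner_zero_left [simp]: "cinner 0 y = 0"
  using cinner_diff_left[of 0 0 y] by simp

lemma cinner_zero_right [simp]: "cinner x 0 = 0"
  using cinner_diff_right[of x 0 0] by simp

lemma Re_cinner_self: "Re (cinner x x) = (norm x)\<^sup>2"
  using cinner_self_nonneg[of x] by (simp add: norm_eq_sqrt_cinner complex_nonneg_Reals_iff)

lemma cinner_self: "cinner x x = of_real ((norm x)\<^sup>2)"
  using cinner_self_nonneg[of x] Re_cinner_self[of x]
  by (simp add: complex_eq_iff complex_nonneg_Reals_iff)

lemma norm_scaleC: "norm (c *\<^sub>C x) = cmod c * norm (x::'a::complex_hilbert_space)"
proof -
  have "(of_real ((norm (c *\<^sub>C x))\<^sup>2) :: complex) = cnj c * (c * cinner x x)"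
    by (simp only: cinner_self[symmetric] cinner_scaleC_left cinner_scaleC_right)
  also have "\<dots> = (c * cnj c) * cinner x x"
    by (simp add: mult.commute mult.left_commute)
  also have "\<dots> = of_real ((cmod c)\<^sup>2 * (norm x)\<^sup>2)"
    by (simp only: complex_norm_square[symmetric] cinner_self of_real_mult)
  finally have "(norm (c *\<^sub>C x))\<^sup>2 = (cmod c * norm x)\<^sup>2"
    by (simp only: of_real_eq_iff power_mult_distrib)
  thus ?thesis
    by (simp add: power2_eq_iff_nonneg)
qed

lemma bounded_clinearD:
  assumes "bounded_clinear S"
  shows "bounded_linear S" "S (x + y) = S x + S y" "S (x - y) = S x - S y"
    "S (c *\<^sub>C x) = c *\<^sub>C S x" "S 0 = 0"
proof -
  show bl: "bounded_linear S" and "S (c *\<^sub>C x) = c *\<^sub>C S x"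
    using assms by (auto simp: bounded_clinear_def)
  interpret bounded_linear S by (rule bl)
  show "S (x + y) = S x + S y" "S (x - y) = S x - S y" "S 0 = 0"
    by (simp_all add: add diff zero)
qed

lemma bounded_clinearI:
  assumes "\<And>x y. S (x + y) = S x + S y" "\<And>c x. S (c *\<^sub>C x) = c *\<^sub>C S x"
    and "\<And>x. norm (S x) \<le> C * norm x"
  shows "bounded_clinear S"
  unfolding bounded_clinear_def
proof (intro conjI allI)
  show "bounded_linear S"
    by (rule bounded_linear_intro[where K = C])
      (use assms in \<open>simp_all add: scaleC_of_real[symmetric] mult.commute\<close>)
qed (rule assms(2))

lemma bounded_clinear_scaleC:
  assumes "bounded_clinear S"
  shows "bounded_clinear (\<lambda>x. c *\<^sub>C S x)"
proof -
  obtain C where C: "\<And>x. norm (S x) \<le> norm x * C"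
    using bounded_linear.bounded[OF bounded_clinearD(1)[OF assms]] by blast
  show ?thesis
  proof (rule bounded_clinearI)
    show "norm (c *\<^sub>C S x) \<le> (cmod c * C) * norm x" for x
      using mult_left_mono[OF C[of x], of "cmod c"] by (simp add: norm_scaleC ac_simps)
  qed (simp_all add: bounded_clinearD[OF assms] scaleC_add_right scaleC_scaleC mult.commute)
qed

lemma bounded_clinear_add:
  assumes "bounded_clinear S" "bounded_clinear R"
  shows "bounded_clinear (\<lambda>x. S x + R x)"
  using assms by (auto simp: bounded_clinear_def scaleC_add_right intro: bounded_linear_add)

lemma bounded_clinear_diff:
  assumes "bounded_clinear S" "bounded_clinear R"
  shows "bounded_clinear (\<lambda>x. S x - R x)"
  using assms by (auto simp: bounded_clinear_def scaleC_diff_right intro: bounded_linear_sub)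

lemma bounded_clinear_compose:
  assumes "bounded_clinear S" "bounded_clinear R"
  shows "bounded_clinear (\<lambda>x. S (R x))"
  using assms by (auto simp: bounded_clinear_def intro: bounded_linear_compose)

section \<open>The semi-inner product and seminorm of a positive operator\<close>

locale positive_op =
  fixes A :: "'a::complex_hilbert_space \<Rightarrow> 'a"
  assumes positive: "positive_operator A"
begin

lemma bounded_clinear: "bounded_clinear A"
  using positive by (simp add: positive_operator_def)

lemma A_inner_add_left: "A_inner A (x + y) z = A_inner A x z + A_inner A y z"
  by (simp add: A_inner_def bounded_clinearD[OF bounded_clinear] cinner_add_left)

lemma A_inner_diff_left: "A_inner A (x - y) z = A_inner A x z - A_inner A y z"
  by (simp add: A_inner_def bounded_clinearD[OF bounded_clinear] cinner_diff_left)

lemma A_inner_scaleC_left: "A_inner A (c *\<^sub>C x) z = c * A_inner A x z"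
  by (simp add: A_inner_def bounded_clinearD[OF bounded_clinear] cinner_scaleC_left)

lemma A_inner_add_right: "A_inner A x (y + z) = A_inner A x y + A_inner A x z"
  by (simp add: A_inner_def cinner_add_right)

lemma A_inner_diff_right: "A_inner A x (y - z) = A_inner A x y - A_inner A x z"
  by (simp add: A_inner_def cinner_diff_right)

lemma A_inner_scaleC_right: "A_inner A x (c *\<^sub>C y) = cnj c * A_inner A x y"
  by (simp add: A_inner_def cinner_scaleC_right)

lemmas A_inner_simps = A_inner_add_left A_inner_diff_left A_inner_scaleC_left
  A_inner_add_right A_inner_diff_right A_inner_scaleC_right

lemma A_inner_self_nonneg: "A_inner A x x \<in> \<real>\<^sub>\<ge>\<^sub>0"
  using positive by (simp add: positive_operator_def A_inner_def)

lemma A_inner_self: "0 \<le> Re (A_inner A x x)" "Im (A_inner A x x) = 0"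
  using A_inner_self_nonneg[of x] by (simp_all add: complex_nonneg_Reals_iff)

text \<open>The form is real on the diagonal. Expanding it at \<open>x + y\<close> shows that the
  imaginary parts of the two mixed terms are opposite, and expanding it at
  \<open>x + \<i> *\<^sub>C y\<close> that their real parts agree.\<close>

lemma A_inner_commute: "A_inner A x y = cnj (A_inner A y x)"
proof -
  have "Im (A_inner A x y + A_inner A y x) = 0"
    using A_inner_self(2)[of "x + y"] A_inner_self(2)[of x] A_inner_self(2)[of y]
    by (simp add: A_inner_simps)
  moreover have "Re (A_inner A x y) = Re (A_inner A y x)"
    using A_inner_self(2)[of "x + \<i> *\<^sub>C y"] A_inner_self(2)[of x] A_inner_self(2)[of y]
    by (simp add: A_inner_simps)
  ultimately show ?thesis
    by (simp add: complex_eq_iff)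
qed

lemma cinner_A_left: "cinner (A x) y = cinner x (A y)"
  by (metis A_inner_def A_inner_commute cinner_commute)

lemma A_norm_nonneg [simp]: "0 \<le> A_norm A x"
  by (simp add: A_norm_def A_inner_self)

lemma A_norm_square: "(A_norm A x)\<^sup>2 = Re (A_inner A x x)"
  by (simp add: A_norm_def A_inner_self)

lemma A_norm_scaleC: "A_norm A (c *\<^sub>C x) = cmod c * A_norm A x"
proof -
  have "Re (A_inner A (c *\<^sub>C x) (c *\<^sub>C x)) = (cmod c)\<^sup>2 * Re (A_inner A x x)"
    by (simp add: A_inner_simps A_inner_self cmod_power2) (simp add: power2_eq_square algebra_simps)
  thus ?thesis
    by (simp add: A_norm_def real_sqrt_mult)
qed

text \<open>Discriminant argument: the quadratic
  \<open>t \<mapsto> (A_norm A (x + t y))\<^sup>2\<close> with real \<open>t\<close> never becomes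
  negative.\<close>

lemma Re_A_inner_le: "\<bar>Re (A_inner A x y)\<bar> \<le> A_norm A x * A_norm A y"
proof -
  define a b r where "a = Re (A_inner A x x)" and "b = Re (A_inner A y y)"
    and "r = Re (A_inner A x y)"
  have quad: "0 \<le> a + 2 * t * r + t\<^sup>2 * b" for t
    using A_inner_self(1)[of "x + of_real t *\<^sub>C y"] A_inner_commute[of x y]
    by (simp add: A_inner_simps a_def b_def r_def power2_eq_square algebra_simps)
  have "b \<ge> 0" by (simp add: b_def A_inner_self)
  have "r\<^sup>2 \<le> a * b"
  proof (cases "b = 0")
    case True
    have "r = 0"
    proof (rule ccontr)
      assume "r \<noteq> 0"
      \<comment> \<open>\<open>A_norm A y\<close> may vanish for nonzero \<open>y\<close>; the
        quadratic is then the affine function \<open>a + 2 * t * r\<close>, and this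
        \<open>t\<close> gives it the value -1.\<close>
      thus False using quad[of "- (a + 1) / (2 * r)"] True by (simp add: field_simps)
    qed
    thus ?thesis using True by simp
  next
    case False
    \<comment> \<open>Evaluation at the minimiser \<open>- r / b\<close>, multiplied by
      \<open>b\<close> to clear the denominator.\<close>
    have "0 \<le> (a + 2 * (- r / b) * r + (- r / b)\<^sup>2 * b) * b"
      using quad[of "- r / b"] \<open>b \<ge> 0\<close> by (intro mult_nonneg_nonneg) simp_all
    also have "\<dots> = a * b - r\<^sup>2"
      using False by (simp add: field_simps power2_eq_square)
    finally show ?thesis by simp
  qed
  hence "\<bar>r\<bar>\<^sup>2 \<le> (A_norm A x * A_norm A y)\<^sup>2"
    by (simp add: power_mult_distrib A_norm_square a_def b_def)
  thus ?thesis
    unfolding r_def by (rule power2_le_imp_le) simp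
qed

text \<open>Multiplying \<open>x\<close> by a unimodular \<open>c\<close> makes the semi-inner
  product real and nonnegative without changing the seminorm, which reduces the claim to the
  real-part bound.\<close>

lemma A_inner_le: "cmod (A_inner A x y) \<le> A_norm A x * A_norm A y"
proof (cases "A_inner A x y = 0")
  case False
  define z where "z = A_inner A x y"
  define c where "c = cnj z / of_real (cmod z)"
  have "z \<noteq> 0" using False by (simp add: z_def)
  have "c * z = of_real (cmod z)"
    using \<open>z \<noteq> 0\<close> complex_norm_square[of z]
    by (simp add: c_def field_simps power2_eq_square)
  hence "Re (A_inner A (c *\<^sub>C x) y) = cmod z"
    by (simp add: A_inner_simps z_def)
  moreover have "cmod c = 1"
    using \<open>z \<noteq> 0\<close> by (simp add: c_def norm_divide)
  ultimately show ?thesis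
    using Re_A_inner_le[of "c *\<^sub>C x" y] by (simp add: A_norm_scaleC z_def)
qed simp

lemma A_norm_triangle: "A_norm A (x + y) \<le> A_norm A x + A_norm A y"
proof (rule power2_le_imp_le)
  have "(A_norm A (x + y))\<^sup>2 = (A_norm A x)\<^sup>2 + (A_norm A y)\<^sup>2 + 2 * Re (A_inner A x y)"
    using A_inner_commute[of x y] by (simp add: A_norm_square A_inner_simps)
  also have "\<dots> \<le> (A_norm A x + A_norm A y)\<^sup>2"
    using Re_A_inner_le[of x y] by (simp add: power2_sum)
  finally show "(A_norm A (x + y))\<^sup>2 \<le> (A_norm A x + A_norm A y)\<^sup>2" .
qed simp

lemma A_norm_eq_0: "A x = 0 \<Longrightarrow> A_norm A x = 0"
  by (simp add: A_norm_def A_inner_def)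

end

text \<open>For the identity operator the semi-inner product is the inner product itself, so
  Cauchy-Schwarz carries over to \<open>cinner\<close>.\<close>

lemma positive_op_id: "positive_op (\<lambda>x::'a::complex_hilbert_space. x)"
  by unfold_locales
    (simp add: positive_operator_def cinner_self_nonneg bounded_clinear_def bounded_linear_ident)

lemma cinner_le: "cmod (cinner x y) \<le> norm x * norm y"
  using positive_op.A_inner_le[OF positive_op_id, of x y]
  by (simp add: A_norm_def A_inner_def norm_eq_sqrt_cinner)

lemma bounded_linear_cinner_left: "bounded_linear (\<lambda>x. cinner x y)"
  by (rule bounded_linear_intro[where K = "norm y"])
    (simp_all add: cinner_add_left cinner_scaleR_left scaleR_conv_of_real cinner_le)

lemma bounded_linear_cinner_right: "bounded_linear (\<lambda>y. cinner x y)"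
  by (rule bounded_linear_intro[where K = "norm x"])
    (simp_all add: cinner_add_right cinner_scaleR_right scaleR_conv_of_real
      cinner_le[THEN order_trans] mult.commute)

lemma parallelogram:
  "(norm (x + y))\<^sup>2 + (norm (x - y))\<^sup>2 = 2 * (norm x)\<^sup>2 + 2 * (norm (y::'a::complex_hilbert_space))\<^sup>2"
  by (simp add: Re_cinner_self[symmetric] cinner_add_left cinner_add_right
      cinner_diff_left cinner_diff_right)

section \<open>Projections, adjoints and the uniform boundedness principle\<close>

text \<open>A minimising sequence for the distance from \<open>x\<close> to \<open>M\<close> is
  Cauchy by the parallelogram law. Its limit is a nearest point, and a residual not orthogonal to
  \<open>M\<close> could be shortened by moving inside \<open>M\<close>.\<close>

lemma orthogonal_projection:
  fixes M :: "'a::complex_hilbert_space set"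
  assumes "closed M" and zero: "0 \<in> M"
    and add: "\<And>u v. u \<in> M \<Longrightarrow> v \<in> M \<Longrightarrow> u + v \<in> M"
    and scale: "\<And>c u. u \<in> M \<Longrightarrow> c *\<^sub>C u \<in> M"
  shows "\<exists>p\<in>M. \<forall>m\<in>M. cinner (x - p) m = 0"
proof -
  define d where "d = infdist x M"
  have "d \<ge> 0" by (simp add: d_def infdist_nonneg)
  have d_le: "d \<le> norm (x - m)" if "m \<in> M" for m
    using infdist_le[OF that, of x] by (simp add: d_def dist_norm)
  have "\<exists>m\<in>M. norm (x - m) < d + inverse (real (Suc n))" for n
  proof (rule ccontr)
    assume "\<not> ?thesis"
    hence "d + inverse (real (Suc n)) \<le> (INF m\<in>M. dist x m)"
      using zero by (intro cINF_greatest) (auto simp: dist_norm not_less)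
    also have "\<dots> = d"
      using zero unfolding d_def by (subst infdist_notempty) auto
    finally show False
      by (simp add: field_simps)
  qed
  then obtain u where u: "\<And>n. u n \<in> M" "\<And>n. norm (x - u n) < d + inverse (real (Suc n))"
    by metis
  \<comment> \<open>The midpoint of \<open>u i\<close> and \<open>u j\<close> lies in
    \<open>M\<close>, hence at distance at least \<open>d\<close> from \<open>x\<close>. The
    parallelogram law leaves \<open>4 * (d + e)\<^sup>2 - 4 * d\<^sup>2\<close>, and
    \<open>e \<le> 1\<close> turns this into a bound linear in \<open>e\<close>.\<close>
  have dist_u: "(norm (u i - u j))\<^sup>2 \<le> inverse (real (Suc N)) * (8 * d + 4)"
    if "N \<le> i" "N \<le> j" for i j N
  proof -
    define e where "e = inverse (real (Suc N))"
    have e: "0 < e" "e \<le> 1"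
      by (simp_all add: e_def field_simps)
    have close: "(norm (x - u k))\<^sup>2 \<le> (d + e)\<^sup>2" if "N \<le> k" for k
    proof (rule power_mono)
      have "inverse (real (Suc k)) \<le> e"
        unfolding e_def using that by (intro le_imp_inverse_le) auto
      thus "norm (x - u k) \<le> d + e"
        using u(2)[of k] by simp
    qed simp
    have "(1 / 2) *\<^sub>C (u i + u j) \<in> M"
      using u by (intro scale add)
    from d_le[OF this] have "d\<^sup>2 \<le> (norm (x - (1 / 2) *\<^sub>C (u i + u j)))\<^sup>2"
      using \<open>d \<ge> 0\<close> by (rule power_mono)
    moreover have "(x - u i) + (x - u j) = 2 *\<^sub>C (x - (1 / 2) *\<^sub>C (u i + u j))"
      using scaleC_add_left[of 1 1 x] by (simp add: scaleC_diff_right scaleC_scaleC)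
    hence "(norm ((x - u i) + (x - u j)))\<^sup>2 = 4 * (norm (x - (1 / 2) *\<^sub>C (u i + u j)))\<^sup>2"
      by (simp add: norm_scaleC power_mult_distrib)
    moreover have "norm ((x - u i) - (x - u j)) = norm (u i - u j)"
      by (simp add: norm_minus_commute)
    ultimately have "(norm (u i - u j))\<^sup>2 \<le> 4 * (d + e)\<^sup>2 - 4 * d\<^sup>2"
      using parallelogram[of "x - u i" "x - u j"] close[OF that(1)] close[OF that(2)] by simp
    also have "\<dots> = e * (8 * d + 4 * e)"
      by (simp add: power2_eq_square algebra_simps)
    also have "\<dots> \<le> e * (8 * d + 4)"
      using e by (intro mult_left_mono) auto
    finally show ?thesis by (simp add: e_def)
  qed
  have "Cauchy u"
  proof (rule CauchyI)
    fix \<epsilon> :: real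
    assume "\<epsilon> > 0"
    then obtain N where N: "inverse (real (Suc N)) < \<epsilon>\<^sup>2 / (8 * d + 4)"
      using reals_Archimedean[of "\<epsilon>\<^sup>2 / (8 * d + 4)"] \<open>d \<ge> 0\<close> by auto
    hence lt: "inverse (real (Suc N)) * (8 * d + 4) < \<epsilon>\<^sup>2"
      using \<open>d \<ge> 0\<close> by (simp add: pos_less_divide_eq)
    show "\<exists>N. \<forall>i\<ge>N. \<forall>j\<ge>N. norm (u i - u j) < \<epsilon>"
    proof (intro exI allI impI)
      fix i j assume "N \<le> i" "N \<le> j"
      from le_less_trans[OF dist_u[OF this] lt] show "norm (u i - u j) < \<epsilon>"
        using \<open>\<epsilon> > 0\<close> by (intro power2_less_imp_less[of _ \<epsilon>]) auto
    qed
  qed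
  then obtain p where p: "u \<longlonglongrightarrow> p"
    using Cauchy_convergent_iff convergent_def by blast
  have "p \<in> M"
    using closed_sequentially[OF \<open>closed M\<close> _ p] u(1) by blast
  have "norm (x - p) \<le> d"
  proof (rule LIMSEQ_le)
    show "(\<lambda>n. norm (x - u n)) \<longlonglongrightarrow> norm (x - p)"
      by (intro tendsto_intros p)
    show "(\<lambda>n. d + inverse (real (Suc n))) \<longlonglongrightarrow> d"
      using tendsto_add[OF tendsto_const LIMSEQ_inverse_real_of_nat, of d] by simp
  qed (use u(2) in \<open>auto intro: less_imp_le\<close>)
  have "cinner (x - p) m = 0" if m: "m \<in> M" for m
  proof (cases "m = 0")
    case False
    define z s where "z = x - p" and "s = cinner z m"
    \<comment> \<open>\<open>c *\<^sub>C m\<close> is the projection of the residual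
      \<open>z\<close> onto the line through \<open>m\<close>; subtracting it lowers the squared
      norm by \<open>(cmod s)\<^sup>2 / (norm m)\<^sup>2\<close>.\<close>
    define c where "c = s / of_real ((norm m)\<^sup>2)"
    have "norm z \<le> norm (z - c *\<^sub>C m)"
      using d_le[OF add[OF \<open>p \<in> M\<close> scale[OF m, of c]]] \<open>norm (x - p) \<le> d\<close>
      by (simp add: z_def algebra_simps)
    hence "(norm z)\<^sup>2 \<le> (norm (z - c *\<^sub>C m))\<^sup>2"
      by (simp add: power_mono)
    also have "\<dots> = (norm z)\<^sup>2 - 2 * Re (cnj c * s) + (cmod c)\<^sup>2 * (norm m)\<^sup>2"
      using cinner_commute[of m z]
      by (simp add: Re_cinner_self[symmetric] cinner_diff_left cinner_diff_right
          cinner_scaleC_left cinner_scaleC_right s_def)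
        (simp add: cinner_self cmod_power2, simp add: power2_eq_square algebra_simps)
    also have "Re (cnj c * s) = (cmod s)\<^sup>2 / (norm m)\<^sup>2"
      by (simp add: c_def cmod_power2 add_divide_distrib) (simp add: power2_eq_square)
    also have "(cmod c)\<^sup>2 * (norm m)\<^sup>2 = (cmod s)\<^sup>2 / (norm m)\<^sup>2"
      using False by (simp add: c_def norm_divide power_divide norm_mult power2_eq_square)
    finally have "(cmod s)\<^sup>2 / (norm m)\<^sup>2 \<le> 0"
      by simp
    thus ?thesis
      using False by (simp add: divide_le_0_iff s_def z_def)
  qed simp
  with \<open>p \<in> M\<close> show ?thesis by blast
qed

text \<open>Take \<open>q\<close> orthogonal to the kernel of \<open>f\<close> with
  \<open>f q\<close> nonzero. Each \<open>x\<close> minus the right multiple of \<open>q\<close>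
  lies in the kernel, hence is orthogonal to \<open>q\<close>, so \<open>f x\<close> is read off
  from \<open>cinner x q\<close>.\<close>

lemma riesz_representation:
  fixes f :: "'a::complex_hilbert_space \<Rightarrow> complex"
  assumes f: "bounded_linear f" and scale: "\<And>c x. f (c *\<^sub>C x) = c * f x"
  obtains z where "\<And>x. f x = cinner x z"
proof (cases "\<forall>x. f x = 0")
  case True
  thus ?thesis by (intro that[of 0]) simp
next
  case False
  then obtain u where u: "f u \<noteq> 0" by blast
  interpret bounded_linear f by (rule f)
  have "closed {x. f x = 0}"
    by (intro closed_Collect_eq continuous_intros) (simp add: linear_continuous_on f)
  then obtain p where p: "f p = 0" and orth: "\<And>m. f m = 0 \<Longrightarrow> cinner (u - p) m = 0"
    using orthogonal_projection[of "{x. f x = 0}" u] by (auto simp: zero add assms(2))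
  define q where "q = u - p"
  have q: "f q \<noteq> 0"
    using u p by (simp add: q_def diff)
  hence "q \<noteq> 0" by (auto simp: zero)
  show ?thesis
  proof
    fix x
    have "f (x - (f x / f q) *\<^sub>C q) = 0"
      using q by (simp add: diff assms(2))
    from orth[OF this] have "cinner (x - (f x / f q) *\<^sub>C q) q = 0"
      using cinner_commute[of "x - (f x / f q) *\<^sub>C q" q] by (simp add: q_def)
    hence "cinner x q = f x / f q * of_real ((norm q)\<^sup>2)"
      by (simp add: cinner_diff_left cinner_scaleC_left cinner_self)
    thus "f x = cinner x ((cnj (f q) / of_real ((norm q)\<^sup>2)) *\<^sub>C q)"
      using q \<open>q \<noteq> 0\<close> by (simp add: cinner_scaleC_right)
  qed
qed

lemma cinner_ext:
  assumes "\<And>x. cinner x y = cinner x (z::'a::complex_hilbert_space)"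
  shows "y = z"
  using assms[of "y - z"] cinner_diff_right[of "y - z" y z]
  by (simp add: cinner_self_eq_0_iff)

text \<open>Riesz representation supplies the adjoint pointwise; uniqueness by
  \<open>cinner_ext\<close> makes the definite description in \<open>cadjoint\<close>
  meaningful.\<close>

lemma
  fixes T :: "'a::complex_hilbert_space \<Rightarrow> 'a"
  assumes T: "bounded_clinear T"
  shows bounded_clinear_cadjoint: "bounded_clinear (cadjoint T)"
    and cinner_cadjoint: "cinner (T x) y = cinner x (cadjoint T y)"
proof -
  have "\<exists>z. \<forall>x. cinner (T x) y = cinner x z" for y
  proof (rule riesz_representation[of "\<lambda>x. cinner (T x) y"])
    show "bounded_linear (\<lambda>x. cinner (T x) y)"
      by (rule bounded_linear_compose[OF bounded_linear_cinner_left bounded_clinearD(1)[OF T]])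
  qed (auto simp: bounded_clinearD[OF T] cinner_scaleC_left)
  then obtain S where S: "\<And>x y. cinner (T x) y = cinner x (S y)"
    by metis
  obtain C where C: "\<And>x. norm (T x) \<le> norm x * C"
    using bounded_linear.bounded[OF bounded_clinearD(1)[OF T]] by blast
  have "bounded_clinear S"
  proof (rule bounded_clinearI)
    show "S (y + z) = S y + S z" for y z
      by (rule cinner_ext) (simp add: S[symmetric] cinner_add_right)
    show "S (c *\<^sub>C y) = c *\<^sub>C S y" for c y
      by (rule cinner_ext) (simp add: S[symmetric] cinner_scaleC_right)
    show "norm (S y) \<le> C * norm y" for y
    proof (cases "S y = 0")
      case False
      have "(norm (S y))\<^sup>2 = cmod (cinner (T (S y)) y)"
        by (simp only: S cinner_self norm_of_real) simp
      also have "\<dots> \<le> (norm (S y) * C) * norm y"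
        by (rule order_trans[OF cinner_le]) (rule mult_right_mono[OF C], simp)
      finally show ?thesis
        using False by (simp add: power2_eq_square mult.assoc)
    next
      case True
      \<comment> \<open>\<open>C\<close> is not known to be nonnegative, but the bound for
        \<open>T\<close> at \<open>y\<close> itself shows \<open>0 \<le> norm y * C\<close>.\<close>
      thus ?thesis using order_trans[OF norm_ge_zero C[of y]]
        by (simp add: mult.commute)
    qed
  qed
  have "\<exists>!S. bounded_clinear S \<and> (\<forall>x y. cinner (T x) y = cinner x (S y))"
  proof (rule ex1I[of _ S])
    show "S' = S" if "bounded_clinear S' \<and> (\<forall>x y. cinner (T x) y = cinner x (S' y))" for S'
    proof
      show "S' y = S y" for y
        by (rule cinner_ext) (metis S that)
    qed
  qed (use \<open>bounded_clinear S\<close> S in blast)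
  from theI'[OF this, folded cadjoint_def]
  show "bounded_clinear (cadjoint T)" "cinner (T x) y = cinner x (cadjoint T y)"
    by blast+
qed

text \<open>Baire category: the closed sets \<open>E n\<close> of points where the whole family is
  bounded by \<open>n\<close> cover the space, so one of them contains a ball.\<close>

lemma uniform_boundedness_principle:
  fixes F :: "('a::banach \<Rightarrow> 'b::real_normed_vector) set"
  assumes F: "\<And>f. f \<in> F \<Longrightarrow> bounded_linear f"
    and pointwise: "\<And>x. \<exists>C. \<forall>f\<in>F. norm (f x) \<le> C"
  obtains C where "\<And>f x. f \<in> F \<Longrightarrow> norm (f x) \<le> C * norm x"
proof -
  define E where "E n = {x. \<forall>f\<in>F. norm (f x) \<le> real n}" for n
  have E_eq: "E n = (\<Inter>f\<in>F. {x. norm (f x) \<le> real n})" for n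
    by (auto simp: E_def)
  have closed_E: "closed (E n)" for n
    unfolding E_eq
    by (intro closed_INT ballI closed_Collect_le continuous_intros)
      (simp add: linear_continuous_on F)
  have "(\<Union>n. E n) = UNIV"
  proof (intro equalityI subset_UNIV subsetI)
    fix x
    obtain C where "\<forall>f\<in>F. norm (f x) \<le> C" using pointwise by blast
    moreover obtain n where "C \<le> real n" using real_arch_simple by blast
    ultimately have "x \<in> E n" by (force simp: E_def)
    thus "x \<in> (\<Union>n. E n)" by blast
  qed
  hence "interior (\<Union>(range E)) \<noteq> {}" by simp
  hence "\<exists>n. interior (E n) \<noteq> {}"
    using Met_TC.metric_Baire_category_alt[of "range E"] complete_UNIV closed_E
    by (auto)
  then obtain n y where "y \<in> interior (E n)" by blast
  then obtain r where r: "r > 0" "ball y r \<subseteq> E n"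
    by (meson interior_subset open_contains_ball open_interior order_trans)
  show ?thesis
  proof (rule that)
    fix f x assume f: "f \<in> F"
    interpret bounded_linear f by (rule F[OF f])
    show "norm (f x) \<le> (4 * real n / r) * norm x"
    proof (cases "x = 0")
      case False
      \<comment> \<open>Scaling \<open>x\<close> to length \<open>r / 2\<close> keeps
        \<open>y + h\<close> in the ball. Both \<open>f (y + h)\<close> and \<open>f y\<close> have
        norm at most \<open>n\<close>, so \<open>f h\<close> has norm at most \<open>2 * n\<close>;
        undoing the scaling gives the factor \<open>4 * n / r\<close>.\<close>
      define h where "h = (r / (2 * norm x)) *\<^sub>R x"
      have "norm h = r / 2"
        using False r by (simp add: h_def)
      hence "y + h \<in> E n" "y \<in> E n"
        using r by (auto intro!: subsetD[OF r(2)] simp: dist_norm)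
      hence "norm (f (y + h)) \<le> n" "norm (f y) \<le> n"
        using f by (auto simp: E_def)
      hence "norm (f h) \<le> 2 * n"
        using norm_triangle_ineq4[of "f (y + h)" "f y"] by (simp add: add)
      also have "f h = (r / (2 * norm x)) *\<^sub>R f x"
        by (simp add: h_def scaleR)
      finally show ?thesis
        using r False by (simp add: field_simps)
    qed (simp add: zero)
  qed
qed

section \<open>The A-adjoint\<close>

context positive_op
begin

lemma closed_range_subspace:
  shows "0 \<in> closure (range A)"
    and "u \<in> closure (range A) \<Longrightarrow> v \<in> closure (range A) \<Longrightarrow> u + v \<in> closure (range A)"
    and "u \<in> closure (range A) \<Longrightarrow> c *\<^sub>C u \<in> closure (range A)"
proof -
  note lin = bounded_clinearD[OF bounded_clinear]
  have range: "0 \<in> range A" "\<And>u v. u \<in> range A \<Longrightarrow> v \<in> range A \<Longrightarrow> u + v \<in> range A"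
    "\<And>c u. u \<in> range A \<Longrightarrow> c *\<^sub>C u \<in> range A"
    using rangeI[of A 0] by (auto simp: lin(5) lin(2,4)[symmetric])
  show "0 \<in> closure (range A)"
    using range(1) by (rule subsetD[OF closure_subset])
  \<comment> \<open>Sums pass to the closure one argument at a time: first \<open>v\<close> with
    \<open>u\<close> still in the range, then \<open>u\<close>.\<close>
  have add: "u + v \<in> closure (range A)" if u: "u \<in> range A" and v: "v \<in> closure (range A)" for u v
  proof -
    have "(+) u ` closure (range A) \<subseteq> closure (range A)"
      by (rule image_closure_subset)
        (use range(2)[OF u] in \<open>auto intro!: continuous_intros subsetD[OF closure_subset]\<close>)
    with v show ?thesis by (rule subsetD[OF _ imageI, rotated])
  qed
  show "u + v \<in> closure (range A)" if u: "u \<in> closure (range A)" and v: "v \<in> closure (range A)"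
  proof -
    have "(\<lambda>u. u + v) ` closure (range A) \<subseteq> closure (range A)"
      by (rule image_closure_subset) (use add[OF _ v] in \<open>auto intro!: continuous_intros\<close>)
    with u show ?thesis by (rule subsetD[OF _ imageI, rotated])
  qed
  show "c *\<^sub>C u \<in> closure (range A)" if u: "u \<in> closure (range A)"
  proof -
    have "bounded_clinear (\<lambda>x::'a. c *\<^sub>C x)"
      by (rule bounded_clinear_scaleC) (simp add: bounded_clinear_def bounded_linear_ident)
    hence "(*\<^sub>C) c ` closure (range A) \<subseteq> closure (range A)"
      by (intro image_closure_subset linear_continuous_on bounded_clinearD(1))
        (use range(3) in \<open>auto intro!: subsetD[OF closure_subset]\<close>)
    with u show ?thesis by (rule subsetD[OF _ imageI, rotated])
  qed
qed

lemma closed_range_diff: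
  "u \<in> closure (range A) \<Longrightarrow> v \<in> closure (range A) \<Longrightarrow> u - v \<in> closure (range A)"
  using closed_range_subspace(2)[of u "- v"] closed_range_subspace(3)[of v "-1"] by simp

text \<open>The residual \<open>r = x - p\<close> of the projection onto the closed range is
  orthogonal to \<open>A (A r)\<close>; since \<open>A\<close> is symmetric, this says that
  \<open>A r\<close> has norm 0.\<close>

lemma range_null_decomposition:
  obtains p q where "x = p + q" "p \<in> closure (range A)" "A q = 0"
proof -
  obtain p where p: "p \<in> closure (range A)"
      "\<And>m. m \<in> closure (range A) \<Longrightarrow> cinner (x - p) m = 0"
    using orthogonal_projection[of "closure (range A)" x] closed_range_subspace by blast
  have "cinner (A (x - p)) (A (x - p)) = cinner (x - p) (A (A (x - p)))"
    by (rule cinner_A_left)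
  also have "\<dots> = 0"
    by (intro p(2) subsetD[OF closure_subset] rangeI)
  finally have "A (x - p) = 0"
    by (simp add: cinner_self_eq_0_iff)
  with p(1) show ?thesis
    by (intro that[of p "x - p"]) simp_all
qed

text \<open>By continuity the bound extends from the range to its closure, where \<open>p\<close>
  can be tested against itself.\<close>

lemma norm_le_of_closed_range:
  assumes "0 \<le> C" and p: "p \<in> closure (range A)"
    and le: "\<And>u. cmod (cinner p (A u)) \<le> C * norm (A u)"
  shows "norm p \<le> C"
proof -
  have "closed {w. cmod (cinner p w) \<le> C * norm w}"
    by (intro closed_Collect_le continuous_intros)
      (simp add: linear_continuous_on bounded_linear_cinner_right)
  hence "closure (range A) \<subseteq> {w. cmod (cinner p w) \<le> C * norm w}"
    using le by (intro closure_minimal) auto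
  hence *: "norm p * norm p \<le> C * norm p"
    using subsetD[OF _ p, of "{w. cmod (cinner p w) \<le> C * norm w}"]
    by (simp add: cinner_self norm_power power2_eq_square norm_mult)
  thus ?thesis
    using \<open>0 \<le> C\<close> by (cases "p = 0") simp_all
qed

lemma closed_range_null:
  assumes "p \<in> closure (range A)" "A p = 0"
  shows "p = 0"
  using norm_le_of_closed_range[of 0 p] assms by (simp add: cinner_A_left[symmetric])

text \<open>This injectivity of \<open>A\<close> is what makes the A-adjoint unique, and its
  pointwise construction linear.\<close>

lemma closed_range_inj:
  assumes "p \<in> closure (range A)" "q \<in> closure (range A)" "A p = A q"
  shows "p = q"
  using closed_range_null[OF closed_range_diff[OF assms(1,2)]] assms(3)
  by (simp add: bounded_clinearD[OF bounded_clinear])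

text \<open>An instance of Douglas factorisation. \<open>X y\<close> is the component in the closed
  range of a preimage of \<open>cadjoint T (A y)\<close> under \<open>A\<close>; changing the
  preimage by a null vector of \<open>A\<close> does not affect it.\<close>

lemma A_adjoint_exists:
  assumes T: "T \<in> A_adjointable A"
  shows "\<exists>!X. bounded_clinear X \<and> A \<circ> X = cadjoint T \<circ> A \<and> range X \<subseteq> closure (range A)"
proof -
  have bT: "bounded_clinear T" and sub: "range (cadjoint T \<circ> A) \<subseteq> range A"
    using T by (auto simp: A_adjointable_def)
  note lin = bounded_clinearD[OF bounded_clinear]
    bounded_clinearD[OF bounded_clinear_cadjoint[OF bT]]
  have "\<exists>p. p \<in> closure (range A) \<and> A p = cadjoint T (A y)" for y
  proof -
    have "cadjoint T (A y) \<in> range A"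
      by (intro subsetD[OF sub] range_eqI[of _ _ y]) simp
    then obtain z where z: "cadjoint T (A y) = A z"
      by (rule rangeE)
    obtain p q where "z = p + q" "p \<in> closure (range A)" "A q = 0"
      by (rule range_null_decomposition)
    with z have "A p = cadjoint T (A y)"
      by (simp add: lin)
    with \<open>p \<in> _\<close> show ?thesis by blast
  qed
  then obtain X where cl: "X y \<in> closure (range A)" and AX: "A (X y) = cadjoint T (A y)" for y
    by metis
  \<comment> \<open>Against vectors of the range, \<open>X y\<close> pairs by a formula without
    \<open>X\<close> that is visibly continuous in \<open>y\<close>.\<close>
  have X_A: "cinner (X y) (A u) = cinner y (A (T u))" for y u
  proof -
    have "cinner (X y) (A u) = cinner (cadjoint T (A y)) u"
      by (simp only: cinner_A_left[symmetric] AX)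
    also have "\<dots> = cnj (cinner (T u) (A y))"
      by (simp only: cinner_cadjoint[OF bT] cinner_commute[symmetric])
    also have "\<dots> = cinner y (A (T u))"
      by (simp only: cinner_A_left[symmetric] cinner_commute[symmetric])
    finally show ?thesis .
  qed
  \<comment> \<open>Boundedness of \<open>X\<close>: on the ball of \<open>range A\<close> the functionals \<open>\<lambda>y. cinner (X y) w\<close> are
    continuous and bounded pointwise by \<open>norm (X y)\<close>. The factor \<open>inverse (norm (A u))\<close> is \<open>0\<close>
    when \<open>A u = 0\<close>.\<close>
  define F where "F = range (\<lambda>u y. inverse (norm (A u)) *\<^sub>R cinner y (A (T u)))"
  obtain C where C: "\<And>f y. f \<in> F \<Longrightarrow> norm (f y) \<le> C * norm y"
  proof (rule uniform_boundedness_principle[of F])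
    show "bounded_linear f" if "f \<in> F" for f
      using that bounded_linear_const_scaleR[OF bounded_linear_cinner_left]
      by (auto simp: F_def)
    have "norm (inverse (norm (A u)) *\<^sub>R cinner y (A (T u))) \<le> norm (X y)" for u y
      using cinner_le[of "X y" "A u"] X_A[of y u]
      by (cases "A u = 0") (simp_all add: field_simps)
    thus "\<exists>C. \<forall>f\<in>F. norm (f y) \<le> C" for y
      unfolding F_def by blast
  qed blast
  have "bounded_clinear X"
  proof (rule bounded_clinearI)
    show "X (x + y) = X x + X y" for x y
      by (rule closed_range_inj) (simp_all add: cl AX lin closed_range_subspace)
    show "X (c *\<^sub>C y) = c *\<^sub>C X y" for c y
      by (rule closed_range_inj) (simp_all add: cl AX lin closed_range_subspace)
    \<comment> \<open>The uniform bound \<open>C\<close> carries no sign, while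
      \<open>norm_le_of_closed_range\<close> asks for a nonnegative constant; hence
      \<open>\<bar>C\<bar>\<close>.\<close>
    show "norm (X y) \<le> \<bar>C\<bar> * norm y" for y
    proof (rule norm_le_of_closed_range)
      fix u
      have "norm (inverse (norm (A u)) *\<^sub>R cinner y (A (T u))) \<le> C * norm y"
        by (rule C) (auto simp: F_def)
      also have "\<dots> \<le> \<bar>C\<bar> * norm y"
        by (intro mult_right_mono) auto
      finally show "cmod (cinner (X y) (A u)) \<le> \<bar>C\<bar> * norm y * norm (A u)"
        using X_A[of y u] by (cases "A u = 0") (simp_all add: field_simps)
    qed (simp_all add: cl)
  qed
  show ?thesis
  proof (rule ex1I[of _ X])
    show "bounded_clinear X \<and> A \<circ> X = cadjoint T \<circ> A \<and> range X \<subseteq> closure (range A)"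
      using \<open>bounded_clinear X\<close> cl AX by auto
  next
    fix Y assume Y: "bounded_clinear Y \<and> A \<circ> Y = cadjoint T \<circ> A \<and> range Y \<subseteq> closure (range A)"
    show "Y = X"
    proof
      fix y
      have "A (Y y) = A (X y)"
        using Y AX[of y] by (simp add: fun_eq_iff)
      moreover have "Y y \<in> closure (range A)"
        using Y by blast
      ultimately show "Y y = X y"
        using cl closed_range_inj by blast
    qed
  qed
qed

lemma
  assumes T: "T \<in> A_adjointable A"
  shows bounded_clinear_A_adjoint: "bounded_clinear (A_adjoint A T)"
    and A_inner_A_adjoint: "A_inner A (T x) y = A_inner A x (A_adjoint A T y)"
proof -
  have bT: "bounded_clinear T"
    using T by (simp add: A_adjointable_def)
  note X = theI'[OF A_adjoint_exists[OF T], folded A_adjoint_def]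
  thus "bounded_clinear (A_adjoint A T)" by blast
  have "A (A_adjoint A T y) = cadjoint T (A y)"
    using X by (simp add: fun_eq_iff)
  thus "A_inner A (T x) y = A_inner A x (A_adjoint A T y)"
    by (simp add: A_inner_def cinner_A_left cinner_cadjoint[OF bT])
qed

end

section \<open>Seminorms of A-bounded operators\<close>

text \<open>Log-convexity makes the ratios of successive terms nondecreasing. A first ratio
  \<open>r > K\<close> would force growth at least like \<open>r ^ n\<close>, which eventually
  exceeds \<open>B * K ^ n\<close>.\<close>

lemma log_convex_growth:
  fixes a :: "nat \<Rightarrow> real"
  assumes nonneg: "\<And>n. 0 \<le> a n" and convex: "\<And>n. (a (Suc n))\<^sup>2 \<le> a n * a (Suc (Suc n))"
    and growth: "\<And>n. a n \<le> B * K ^ n" and "0 < K"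
  shows "a 1 \<le> K * a 0"
proof (rule ccontr)
  assume "\<not> ?thesis"
  hence gt: "K * a 0 < a 1" by simp
  moreover have "0 \<le> K * a 0"
    using \<open>0 < K\<close> nonneg[of 0] by simp
  ultimately have "0 < a 1" by simp
  \<comment> \<open>If \<open>a 0\<close> were 0, convexity at index 0 would give
    \<open>a 1 = 0\<close>.\<close>
  hence "0 < a 0"
    using convex[of 0] nonneg[of 0] by (cases "a 0 = 0") auto
  define r where "r = a 1 / a 0"
  have r: "K < r"
    using gt \<open>0 < a 0\<close> by (simp add: r_def field_simps)
  have step: "0 < a n \<and> r * a n \<le> a (Suc n)" for n
  proof (induction n)
    case 0
    show ?case using \<open>0 < a 0\<close> by (simp add: r_def)
  next
    case (Suc n)
    have "0 < r" using r \<open>0 < K\<close> by simp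
    hence "0 < r * a n" using Suc by simp
    hence pos: "0 < a (Suc n)" using Suc by linarith
    have "a n * (r * a (Suc n)) \<le> a (Suc n) * a (Suc n)"
      using mult_right_mono[of "r * a n" "a (Suc n)" "a (Suc n)"] Suc pos by (simp add: ac_simps)
    also have "\<dots> \<le> a n * a (Suc (Suc n))"
      using convex[of n] by (simp add: power2_eq_square)
    finally show ?case
      using Suc pos by simp
  qed
  have lower: "a 0 * r ^ n \<le> a n" for n
  proof (induction n)
    case (Suc n)
    have "a 0 * r ^ Suc n \<le> r * a n"
      using mult_left_mono[OF Suc, of r] r \<open>0 < K\<close> by (simp add: ac_simps)
    also have "\<dots> \<le> a (Suc n)" using step by blast
    finally show ?case .
  qed simp
  have "1 < r / K"
    using r \<open>0 < K\<close> by simp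
  then obtain n where "B / a 0 < (r / K) ^ n"
    using real_arch_pow by blast
  hence "B * K ^ n < a 0 * r ^ n"
    using \<open>0 < K\<close> \<open>0 < a 0\<close> by (simp add: power_divide field_simps)
  thus False
    using lower[of n] growth[of n] by simp
qed

context positive_op
begin

lemma A_norm_le_norm:
  obtains B where "0 \<le> B" "\<And>x. A_norm A x \<le> B * norm x"
proof -
  obtain C where "C > 0" and C: "\<And>x. norm (A x) \<le> norm x * C"
    using bounded_linear.pos_bounded[OF bounded_clinearD(1)[OF bounded_clinear]] by blast
  have "A_norm A x \<le> sqrt C * norm x" for x
  proof (rule power2_le_imp_le)
    have "(A_norm A x)\<^sup>2 \<le> cmod (cinner (A x) x)"
      by (simp add: A_norm_square A_inner_def complex_Re_le_cmod)
    also have "\<dots> \<le> norm x * C * norm x"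
      by (rule order_trans[OF cinner_le]) (rule mult_right_mono[OF C], simp)
    finally show "(A_norm A x)\<^sup>2 \<le> (sqrt C * norm x)\<^sup>2"
      using \<open>C > 0\<close> by (simp add: power_mult_distrib) (simp add: power2_eq_square ac_simps)
  qed (use \<open>C > 0\<close> in simp)
  thus ?thesis
    using \<open>C > 0\<close> by (intro that[of "sqrt C"]) auto
qed

text \<open>\<open>G = R \<circ> S\<close> is symmetric for the semi-inner product, so \<open>n \<mapsto> A_norm A (G^n x)\<close> is
  log-convex; as it grows at most like \<open>K^n\<close>, already its first ratio is at most \<open>K\<close>.\<close>

lemma A_bounded:
  assumes S: "bounded_clinear S" and R: "bounded_clinear R"
    and adj: "\<And>x y. A_inner A (S x) y = A_inner A x (R y)"
  obtains C where "0 \<le> C" "\<And>x. A_norm A (S x) \<le> C * A_norm A x"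
proof -
  define G where "G = (\<lambda>x. R (S x))"
  have symmetric: "A_inner A (G x) y = A_inner A x (G y)" for x y
    unfolding G_def by (metis adj A_inner_commute)
  obtain K where "K > 0" and K: "\<And>x. norm (G x) \<le> norm x * K"
    using bounded_linear.pos_bounded[OF bounded_clinearD(1)[OF bounded_clinear_compose[OF R S]]]
    unfolding G_def by blast
  obtain B where "0 \<le> B" and B: "\<And>x. A_norm A x \<le> B * norm x"
    by (rule A_norm_le_norm) blast
  have G_le: "A_norm A (G x) \<le> K * A_norm A x" for x
  proof -
    have iter: "norm ((G ^^ n) x) \<le> norm x * K ^ n" for n
    proof (induction n)
      case (Suc n)
      have "norm ((G ^^ Suc n) x) \<le> norm ((G ^^ n) x) * K"
        using K by simp
      also have "\<dots> \<le> norm x * K ^ n * K"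
        using Suc \<open>K > 0\<close> by (intro mult_right_mono) auto
      finally show ?case by (simp add: ac_simps)
    qed simp
    have "A_norm A ((G ^^ 1) x) \<le> K * A_norm A ((G ^^ 0) x)"
    proof (rule log_convex_growth[where a = "\<lambda>n. A_norm A ((G ^^ n) x)"])
      show "A_norm A ((G ^^ n) x) \<le> (B * norm x) * K ^ n" for n
        using order_trans[OF B mult_left_mono[OF iter \<open>0 \<le> B\<close>]] by (simp add: ac_simps)
      \<comment> \<open>By symmetry one \<open>G\<close> moves across: the squared seminorm of
        \<open>G^(n+1) x\<close> is the semi-inner product of \<open>G^n x\<close> and
        \<open>G^(n+2) x\<close>, and Cauchy-Schwarz applies.\<close>
      show "(A_norm A ((G ^^ Suc n) x))\<^sup>2 \<le> A_norm A ((G ^^ n) x) * A_norm A ((G ^^ Suc (Suc n)) x)" for n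
        using abs_le_D1[OF Re_A_inner_le[of "(G ^^ n) x" "(G ^^ Suc (Suc n)) x"]]
        by (simp add: A_norm_square symmetric)
    qed (use \<open>K > 0\<close> in auto)
    thus ?thesis by simp
  qed
  have "A_norm A (S x) \<le> sqrt K * A_norm A x" for x
  proof (rule power2_le_imp_le)
    have "(A_norm A (S x))\<^sup>2 = Re (A_inner A x (G x))"
      by (simp add: A_norm_square adj G_def)
    also have "\<dots> \<le> A_norm A x * (K * A_norm A x)"
      using order_trans[OF abs_le_D1[OF Re_A_inner_le] mult_left_mono[OF G_le A_norm_nonneg]] .
    also have "\<dots> = (sqrt K * A_norm A x)\<^sup>2"
      using \<open>K > 0\<close> by (simp add: power_mult_distrib power2_eq_square)
    finally show "(A_norm A (S x))\<^sup>2 \<le> (sqrt K * A_norm A x)\<^sup>2" .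
  qed (use \<open>K > 0\<close> in simp)
  thus ?thesis
    using \<open>K > 0\<close> by (intro that[of "sqrt K"]) auto
qed

section \<open>Homogeneous bounds by the operator seminorm and the numerical radius\<close>

lemma A_normalize:
  assumes "A_norm A x \<noteq> 0"
  shows "A_norm A ((1 / of_real (A_norm A x)) *\<^sub>C x) = 1"
  using assms by (simp add: A_norm_scaleC norm_divide)

text \<open>The assumption \<open>0 \<le> M\<close> accounts for the element 0 inserted into the
  supremum.\<close>

lemma A_opnorm_le:
  assumes "0 \<le> M" "\<And>x. A_norm A x = 1 \<Longrightarrow> A_norm A (S x) \<le> M"
  shows "A_opnorm A S \<le> M"
  unfolding A_opnorm_def by (rule cSup_least) (use assms in auto)

text \<open>The supremum runs over the closed range only. A general \<open>x\<close> differs from a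
  vector there by some \<open>q\<close> with \<open>A q = 0\<close>; the bound \<open>C\<close>,
  which also makes the supremum finite, forces \<open>S q\<close> to have seminorm 0.\<close>

lemma
  assumes S: "bounded_clinear S"
    and C: "0 \<le> C" "\<And>x. A_norm A (S x) \<le> C * A_norm A x"
  shows A_opnorm_nonneg: "0 \<le> A_opnorm A S"
    and A_norm_le_opnorm: "A_norm A (S x) \<le> A_opnorm A S * A_norm A x"
proof -
  have bdd: "bdd_above (insert 0 {A_norm A (S x) | x. x \<in> closure (range A) \<and> A_norm A x = 1})"
    using C by (intro bdd_aboveI[of _ C]) (auto, metis mult.right_neutral)
  show nonneg: "0 \<le> A_opnorm A S"
    unfolding A_opnorm_def by (rule cSup_upper[OF _ bdd]) simp
  have on_range: "A_norm A (S p) \<le> A_opnorm A S * A_norm A p" if p: "p \<in> closure (range A)" for p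
  proof (cases "A_norm A p = 0")
    case True
    thus ?thesis using C(2)[of p] by simp
  next
    case False
    hence pos: "0 < A_norm A p"
      using A_norm_nonneg[of p] by (simp add: less_le)
    define c :: complex where "c = 1 / of_real (A_norm A p)"
    have "A_norm A (S (c *\<^sub>C p)) \<le> A_opnorm A S"
      unfolding A_opnorm_def
      by (rule cSup_upper[OF _ bdd])
        (use A_normalize[OF False] closed_range_subspace(3)[OF p] in \<open>auto simp: c_def\<close>)
    thus ?thesis
      using pos by (simp add: bounded_clinearD[OF S] A_norm_scaleC c_def norm_divide field_simps)
  qed
  obtain p q where x: "x = p + q" and p: "p \<in> closure (range A)" and q: "A q = 0"
    by (rule range_null_decomposition)
  have "A_norm A (S q) = 0"
    using C(2)[of q] A_norm_nonneg[of "S q"] by (simp add: A_norm_eq_0[OF q])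
  hence "A_norm A (S x) \<le> A_norm A (S p)"
    using A_norm_triangle[of "S p" "S q"] by (simp add: x bounded_clinearD[OF S])
  also have "\<dots> \<le> A_opnorm A S * A_norm A p"
    by (rule on_range[OF p])
  also have "A_norm A p = A_norm A x"
    by (simp add: A_norm_def A_inner_simps x)
      (simp add: A_inner_def cinner_A_left q)
  finally show "A_norm A (S x) \<le> A_opnorm A S * A_norm A x" .
qed

text \<open>The quadratic form scales by the square of the seminorm, so unit vectors suffice. The
  bound \<open>C\<close> makes the supremum finite and settles vectors of seminorm 0, which cannot
  be normalised.\<close>

lemma
  assumes S: "bounded_clinear S"
    and C: "0 \<le> C" "\<And>x. A_norm A (S x) \<le> C * A_norm A x"
  shows A_numerical_radius_nonneg: "0 \<le> A_numerical_radius A S"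
    and A_inner_le_numerical_radius:
      "cmod (A_inner A (S x) x) \<le> A_numerical_radius A S * (A_norm A x)\<^sup>2"
proof -
  have le: "cmod (A_inner A (S x) x) \<le> C * (A_norm A x)\<^sup>2" for x
    using order_trans[OF A_inner_le mult_right_mono[OF C(2) A_norm_nonneg]]
    by (simp add: power2_eq_square mult.assoc)
  have bdd: "bdd_above (insert 0 {cmod (A_inner A (S x) x) | x. A_norm A x = 1})"
    using C(1) by (intro bdd_aboveI[of _ C]) (auto, metis le mult.right_neutral one_power2)
  show "0 \<le> A_numerical_radius A S"
    unfolding A_numerical_radius_def by (rule cSup_upper[OF _ bdd]) simp
  show "cmod (A_inner A (S x) x) \<le> A_numerical_radius A S * (A_norm A x)\<^sup>2"
  proof (cases "A_norm A x = 0")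
    case True
    thus ?thesis using le[of x] by simp
  next
    case False
    hence pos: "0 < A_norm A x"
      using A_norm_nonneg[of x] by (simp add: less_le)
    define c :: complex where "c = 1 / of_real (A_norm A x)"
    have "cmod (A_inner A (S (c *\<^sub>C x)) (c *\<^sub>C x)) \<le> A_numerical_radius A S"
      unfolding A_numerical_radius_def
      by (rule cSup_upper[OF _ bdd]) (use A_normalize[OF False] in \<open>auto simp: c_def\<close>)
    thus ?thesis
      using pos
      by (simp add: bounded_clinearD[OF S] A_inner_simps c_def norm_mult norm_divide
          field_simps power2_eq_square)
  qed
qed

text \<open>For a symmetric operator, polarisation writes the real part of a mixed term as a
  difference of diagonal terms, which \<open>w\<close> controls; the parallelogram law adds up their
  bounds.\<close>

lemma A_selfadjoint_norm_le:
  assumes H: "bounded_clinear H" and adj: "\<And>x y. A_inner A (H x) y = A_inner A x (H y)"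
    and "0 \<le> w" and w: "\<And>x. cmod (A_inner A (H x) x) \<le> w * (A_norm A x)\<^sup>2"
    and x: "A_norm A x = 1"
  shows "A_norm A (H x) \<le> w"
proof -
  define t where "t = A_norm A (H x)"
  \<comment> \<open>With this scaling \<open>u\<close> and \<open>H x\<close> have the same seminorm
    \<open>t\<close>, so polarisation yields \<open>t\<^sup>3 \<le> w * t\<^sup>2\<close> without
    dividing by \<open>t\<close>.\<close>
  define u where "u = of_real t *\<^sub>C x"
  have "4 * Re (A_inner A (H u) (H x)) =
      Re (A_inner A (H (u + H x)) (u + H x)) - Re (A_inner A (H (u - H x)) (u - H x))"
    using A_inner_commute[of "H (H x)" u] adj[of "H x" u] adj[of u "H x"]
    by (simp add: A_inner_simps bounded_clinearD[OF H])
  also have "\<dots> \<le> w * (A_norm A (u + H x))\<^sup>2 + w * (A_norm A (u - H x))\<^sup>2"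
    using order_trans[OF abs_Re_le_cmod w, of "u + H x"]
      order_trans[OF abs_Re_le_cmod w, of "u - H x"] by linarith
  also have "\<dots> = w * (2 * (A_norm A u)\<^sup>2 + 2 * (A_norm A (H x))\<^sup>2)"
    by (simp add: A_norm_square A_inner_simps algebra_simps)
  also have "\<dots> = 4 * w * t\<^sup>2"
    by (simp add: u_def A_norm_scaleC x t_def)
  also have "Re (A_inner A (H u) (H x)) = t * t\<^sup>2"
    by (simp add: u_def bounded_clinearD[OF H] A_inner_simps t_def A_norm_square)
  finally have "t * t\<^sup>2 \<le> w * t\<^sup>2" by simp
  thus ?thesis
    using \<open>0 \<le> w\<close> by (cases "t = 0") (simp_all add: t_def[symmetric])
qed

end

section \<open>The lower bound for the numerical radius via the Cartesian decomposition\<close>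

theorem theorem2p4:
  fixes A T :: "'a::complex_hilbert_space \<Rightarrow> 'a"
  assumes "positive_operator A"
    and "T \<in> A_adjointable A"
  shows "A_numerical_radius A T \<ge>
    sqrt (1 / 4 * A_opnorm A (\<lambda>x. A_adjoint A T (T x) + T (A_adjoint A T x))
      + 1 / 2 * \<bar>(A_opnorm A (A_Re A T))\<^sup>2 - (A_opnorm A (A_Im A T))\<^sup>2\<bar>)"
proof -
  interpret positive_op A by unfold_locales (rule assms(1))
  define X where "X = A_adjoint A T"
  define H K where "H = A_Re A T" and "K = A_Im A T"
  define w h k where "w = A_numerical_radius A T" and "h = A_opnorm A H" and "k = A_opnorm A K"
  have H_eq: "H x = (1 / 2) *\<^sub>C (T x + X x)"
    and K_eq: "K x = (1 / (2 * \<i>)) *\<^sub>C (T x - X x)" for x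
    by (simp_all add: H_def K_def A_Re_def A_Im_def X_def)
  have T: "bounded_clinear T"
    using assms(2) by (simp add: A_adjointable_def)
  have X: "bounded_clinear X"
    unfolding X_def by (rule bounded_clinear_A_adjoint[OF assms(2)])
  have H: "bounded_clinear H"
    unfolding H_def A_Re_def
    by (fold X_def) (rule bounded_clinear_scaleC[OF bounded_clinear_add[OF T X]])
  have K: "bounded_clinear K"
    unfolding K_def A_Im_def
    by (fold X_def) (rule bounded_clinear_scaleC[OF bounded_clinear_diff[OF T X]])
  have adj: "A_inner A (T x) y = A_inner A x (X y)" for x y
    unfolding X_def by (rule A_inner_A_adjoint[OF assms(2)])
  have adj': "A_inner A (X x) y = A_inner A x (T y)" for x y
    by (metis adj A_inner_commute)
  have H_adj: "A_inner A (H x) y = A_inner A x (H y)" for x y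
    by (simp add: H_eq A_inner_simps adj adj' add.commute)
  have K_adj: "A_inner A (K x) y = A_inner A x (K y)" for x y
    by (simp add: K_eq A_inner_simps adj adj' field_simps)
  have T_eq: "T x = H x + \<i> *\<^sub>C K x" and X_eq: "X x = H x - \<i> *\<^sub>C K x" for x
    by (simp_all add: H_eq K_eq scaleC_scaleC scaleC_add_right scaleC_diff_right
        scaleC_add_left[symmetric])

  \<comment> \<open>The three bounds come from adjoint pairs: \<open>T\<close> with
    \<open>X\<close>, while \<open>H\<close> and \<open>K\<close> are their own adjoints.\<close>
  obtain CT where CT: "0 \<le> CT" "\<And>x. A_norm A (T x) \<le> CT * A_norm A x"
    by (rule A_bounded[OF T X adj]) blast
  obtain CH where CH: "0 \<le> CH" "\<And>x. A_norm A (H x) \<le> CH * A_norm A x"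
    by (rule A_bounded[OF H H H_adj]) blast
  obtain CK where CK: "0 \<le> CK" "\<And>x. A_norm A (K x) \<le> CK * A_norm A x"
    by (rule A_bounded[OF K K K_adj]) blast
  note h = A_opnorm_nonneg[OF H CH, folded h_def] A_norm_le_opnorm[OF H CH, folded h_def]
  note k = A_opnorm_nonneg[OF K CK, folded k_def] A_norm_le_opnorm[OF K CK, folded k_def]
  note w = A_numerical_radius_nonneg[OF T CT, folded w_def]
    A_inner_le_numerical_radius[OF T CT, folded w_def]

  have real: "Im (A_inner A (H x) x) = 0" "Im (A_inner A (K x) x) = 0" for x
    using A_inner_commute[of "H x" x] A_inner_commute[of "K x" x] H_adj[of x x] K_adj[of x x]
    by (simp_all add: complex_eq_iff)
  have "A_inner A (T x) x = A_inner A (H x) x + \<i> * A_inner A (K x) x" for x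
    by (simp add: T_eq A_inner_simps)
  hence "cmod (A_inner A (H x) x) \<le> cmod (A_inner A (T x) x)"
    and "cmod (A_inner A (K x) x) \<le> cmod (A_inner A (T x) x)" for x
    by (simp_all add: cmod_def real)
  hence num: "cmod (A_inner A (H x) x) \<le> w * (A_norm A x)\<^sup>2"
    "cmod (A_inner A (K x) x) \<le> w * (A_norm A x)\<^sup>2" for x
    using w(2)[of x] by (meson order_trans)+
  have "h \<le> w"
    unfolding h_def by (rule A_opnorm_le[OF w(1) A_selfadjoint_norm_le[OF H H_adj w(1) num(1)]])
  have "k \<le> w"
    unfolding k_def by (rule A_opnorm_le[OF w(1) A_selfadjoint_norm_le[OF K K_adj w(1) num(2)]])

  have "A_opnorm A (\<lambda>x. X (T x) + T (X x)) \<le> 2 * (h\<^sup>2 + k\<^sup>2)"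
  proof (rule A_opnorm_le)
    fix x assume x: "A_norm A x = 1"
    \<comment> \<open>In \<open>(H - iK)(H + iK) + (H + iK)(H - iK)\<close> the mixed products
      cancel and the squares double.\<close>
    have "X (T x) + T (X x) = 2 *\<^sub>C (H (H x) + K (K x))"
      unfolding X_eq[of "T x"] T_eq[of "X x"]
      using scaleC_add_left[of 1 1 "H (H x)"] scaleC_add_left[of 1 1 "K (K x)"]
      by (simp add: T_eq[of x] X_eq[of x] bounded_clinearD[OF H] bounded_clinearD[OF K]
          scaleC_add_right scaleC_diff_right scaleC_scaleC)
    hence "A_norm A (X (T x) + T (X x)) = 2 * A_norm A (H (H x) + K (K x))"
      by (simp add: A_norm_scaleC)
    also have "\<dots> \<le> 2 * (A_norm A (H (H x)) + A_norm A (K (K x)))"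
      by (intro mult_left_mono A_norm_triangle) simp
    also have "\<dots> \<le> 2 * (h\<^sup>2 + k\<^sup>2)"
      using order_trans[OF h(2)[of "H x"] mult_left_mono[OF h(2)[of x] h(1)]]
        order_trans[OF k(2)[of "K x"] mult_left_mono[OF k(2)[of x] k(1)]]
      by (simp add: x power2_eq_square)
    finally show "A_norm A (X (T x) + T (X x)) \<le> 2 * (h\<^sup>2 + k\<^sup>2)" .
  qed simp
  moreover have "h\<^sup>2 \<le> w\<^sup>2" "k\<^sup>2 \<le> w\<^sup>2"
    using \<open>h \<le> w\<close> \<open>k \<le> w\<close> h(1) k(1) by (simp_all add: power_mono)
  moreover have "1 / 4 * n + 1 / 2 * \<bar>a - b\<bar> \<le> c" if "n \<le> 2 * (a + b)" "a \<le> c" "b \<le> c" for n a b c :: real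
    using that by (cases "a \<le> b") (simp_all add: field_simps)
  ultimately have "1 / 4 * A_opnorm A (\<lambda>x. X (T x) + T (X x)) + 1 / 2 * \<bar>h\<^sup>2 - k\<^sup>2\<bar> \<le> w\<^sup>2"
    by blast
  hence "sqrt (1 / 4 * A_opnorm A (\<lambda>x. X (T x) + T (X x)) + 1 / 2 * \<bar>h\<^sup>2 - k\<^sup>2\<bar>) \<le> w"
    using w(1) by (rule real_le_lsqrt[rotated])
  thus ?thesis
    by (simp only: w_def h_def k_def H_def K_def X_def)
qed

end
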